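(* Let $\mu$ be a measure on $\mathbb{R}^n$. If $x_0\in\mathbb{R}^n$ is a $\sigma$-point of $\mu$ with $D_\sigma\mu(x_0)=L\in\mathbb{C}$, then the strong derivative of $\mu$ at $x_0$ exists and is equal to $L$.
   Context: $m$ is Lebesgue measure on $\mathbb{R}^n$, $\|\cdot\|$ is the Euclidean norm, and $B(x,r)$ is the open Euclidean ball. "Measure" means a complex or signed Borel measure $\mu$ on $\mathbb{R}^n$ whose total variation $|\mu|$ is finite on compact sets (only bounded Borel sets are evaluated below). $\sigma$-point: $x_0$ is a $\sigma$-point of $\mu$ with $D_\sigma\mu(x_0)=L\in\mathbb{C}$ if for each $\epsilon>0$ there is $\delta>0$ such that $|\mu(B(x,r))-L\,m(B(x,r))|<\epsilon(\|x-x_0\|+r)^n$ whenever $\|x-x_0\|<\delta$ and $0<r<\delta$. Strong derivative: $\mu$ has strong derivative $L\in\mathbb{C}$ at $x_0$, written $D\mu(x_0)=L$, if $\lim_{r\to0^+}\frac{\mu(x_0+rB)}{m(rB)}=L$ for every open ball $B\subset\mathbb{R}^n$ (with arbitrary center and radius), where $rB=\{rx: x\in B\}$. *)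

theory Defs
  imports "HOL-Analysis.Analysis"
begin

definition bounded_borel_sets :: "(real ^ 'n) set set" where
  "bounded_borel_sets = {A. A \<in> sets borel \<and> bounded A}"

definition total_variation :: "((real ^ 'n) set \<Rightarrow> complex) \<Rightarrow> (real ^ 'n) set \<Rightarrow> ennreal" where
  "total_variation \<mu> E =
     (SUP A \<in> {A :: nat \<Rightarrow> (real ^ 'n) set.
                 range A \<subseteq> bounded_borel_sets \<and> disjoint_family A \<and> (\<Union>i. A i) = E}.
        \<Sum>i. ennreal (norm (\<mu> (A i))))"

text \<open>
  A complex or signed Borel measure with total variation finite on compact sets has finite values
  on bounded Borel sets, but it need not have one on an unbounded Borel set. It is therefore
  represented by a complex-valued set function that is constrained only on the bounded Borel sets;
  its values elsewhere are irrelevant. A signed measure is the case of real values. Additivity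
  applied to the constant sequence of empty sets forces \<open>\<mu> {} = 0\<close>.
\<close>

definition locally_finite_complex_measure :: "((real ^ 'n) set \<Rightarrow> complex) \<Rightarrow> bool" where
  "locally_finite_complex_measure \<mu> \<longleftrightarrow>
     (\<forall>A :: nat \<Rightarrow> (real ^ 'n) set.
        range A \<subseteq> bounded_borel_sets \<and> disjoint_family A \<and> bounded (\<Union>i. A i) \<longrightarrow>
          (\<lambda>i. \<mu> (A i)) sums \<mu> (\<Union>i. A i)) \<and>
     (\<forall>K. compact K \<longrightarrow> total_variation \<mu> K < \<infinity>)"

definition has_sigma_derivative ::
    "((real ^ 'n) set \<Rightarrow> complex) \<Rightarrow> complex \<Rightarrow> real ^ 'n \<Rightarrow> bool" where
  "has_sigma_derivative \<mu> L x0 \<longleftrightarrow>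
     (\<forall>\<epsilon>>0. \<exists>\<delta>>0. \<forall>x r. norm (x - x0) < \<delta> \<and> 0 < r \<and> r < \<delta> \<longrightarrow>
        norm (\<mu> (ball x r) - L * complex_of_real (measure lebesgue (ball x r)))
          < \<epsilon> * (norm (x - x0) + r) ^ CARD('n))"

definition has_strong_derivative ::
    "((real ^ 'n) set \<Rightarrow> complex) \<Rightarrow> complex \<Rightarrow> real ^ 'n \<Rightarrow> bool" where
  "has_strong_derivative \<mu> L x0 \<longleftrightarrow>
     (\<forall>c s. s > 0 \<longrightarrow>
        ((\<lambda>r. \<mu> ((+) x0 ` (*\<^sub>R) r ` ball c s) /
              complex_of_real (measure lebesgue ((*\<^sub>R) r ` ball c s))) \<longlongrightarrow> L) (at_right 0))"

end

theory Submission
  imports Defs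
begin

text \<open>The set \<open>x0 + r B(c,s)\<close> is itself the ball of radius \<open>r * s\<close>
  about \<open>x0 + r *\<^sub>R c\<close>, whose center lies at distance \<open>r * norm c\<close>
  from \<open>x0\<close>. The error allowed at a \<sigma>-point is therefore a small multiple of
  \<open>(r * (norm c + s)) ^ n\<close>, of the same order in \<open>r\<close> as the volume of that
  ball. The quotient of the two depends only on the fixed ball \<open>B(c,s)\<close>, so it can be
  absorbed into the choice of \<epsilon>.\<close>

theorem proposition3p2:
  fixes \<mu> :: "(real ^ 'n) set \<Rightarrow> complex" and x0 :: "real ^ 'n" and L :: complex
  assumes "locally_finite_complex_measure \<mu>"
    and "has_sigma_derivative \<mu> L x0"
  shows "has_strong_derivative \<mu> L x0"
  unfolding has_strong_derivative_def
proof (intro allI impI tendstoI)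
  fix c :: "real ^ 'n" and s e :: real
  assume s: "s > 0" and e: "e > 0"
  define V where "V = unit_ball_vol (real CARD('n))"
  have V: "V > 0" by (simp add: V_def)
  define R where "R = norm c + s"
  have R: "R > 0" using s by (simp add: R_def add_nonneg_pos)
  \<comment> \<open>Chosen so that the error bound \<open>\<epsilon> * (r * R) ^ n\<close> is
    exactly \<open>e\<close> times the volume \<open>V * (r * s) ^ n\<close>, for every
    \<open>r > 0\<close>.\<close>
  define \<epsilon> where "\<epsilon> = e * (V * s ^ CARD('n)) / R ^ CARD('n)"
  have "\<epsilon> > 0" using e V s R by (simp add: \<epsilon>_def)
  then obtain \<delta> where "\<delta> > 0" and
    \<delta>: "\<And>x r. norm (x - x0) < \<delta> \<Longrightarrow> 0 < r \<Longrightarrow> r < \<delta> \<Longrightarrow>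
        norm (\<mu> (ball x r) - L * complex_of_real (measure lebesgue (ball x r)))
          < \<epsilon> * (norm (x - x0) + r) ^ CARD('n)"
    using assms(2) unfolding has_sigma_derivative_def by meson
  \<comment> \<open>Below \<open>\<delta> / R\<close> the sum \<open>r * norm c + r * s\<close> is
    less than \<delta>; both terms being nonnegative, the center distance and the radius are each
    less than \<delta>.\<close>
  have "\<forall>\<^sub>F r in at_right 0. r \<in> {0<..<\<delta> / R}"
    using \<open>\<delta> > 0\<close> R by (intro eventually_at_right_real) simp
  then show "\<forall>\<^sub>F r in at_right 0. dist (\<mu> ((+) x0 ` (*\<^sub>R) r ` ball c s) /
      complex_of_real (measure lebesgue ((*\<^sub>R) r ` ball c s))) L < e"
  proof eventually_elim
    case (elim r)
    then have r: "r > 0" and rR: "r * norm c + r * s < \<delta>"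
      using R by (simp_all add: field_simps R_def)
    define x where "x = x0 + r *\<^sub>R c"
    define m where "m = V * (r * s) ^ CARD('n)"
    have m: "m > 0" using V r s by (simp add: m_def)
    \<comment> \<open>The center is left free: the error bound involves the ball about
      \<open>x\<close>, while the denominator of the goal involves the untranslated ball about
      \<open>r *\<^sub>R c\<close>.\<close>
    have vol: "measure lebesgue (ball y (r * s)) = m" for y :: "real ^ 'n"
      using r s by (simp add: content_ball m_def V_def)
    have x: "norm (x - x0) = r * norm c" using r by (simp add: x_def)
    have "r * norm c \<ge> 0" "r * s > 0" using r s by simp_all
    then have "norm (\<mu> (ball x (r * s)) - L * complex_of_real m) < \<epsilon> * (r * norm c + r * s) ^ CARD('n)"
      using \<delta>[of x "r * s"] rR by (simp add: x vol)
    also have "r * norm c + r * s = r * R" by (simp add: R_def algebra_simps)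
    also have "\<epsilon> * (r * R) ^ CARD('n) = e * m"
      using R by (simp add: \<epsilon>_def m_def power_mult_distrib)
    finally have "norm (\<mu> (ball x (r * s)) - L * complex_of_real m) / m < e"
      using m by (simp add: divide_simps)
    also have "norm (\<mu> (ball x (r * s)) - L * complex_of_real m) / m
        = norm ((\<mu> (ball x (r * s)) - L * complex_of_real m) / complex_of_real m)"
      using m by (simp add: norm_divide)
    also have "(\<mu> (ball x (r * s)) - L * complex_of_real m) / complex_of_real m
        = \<mu> (ball x (r * s)) / complex_of_real m - L"
      using m by (simp add: diff_divide_distrib)
    finally show ?case
      using r by (simp add: ball_scale vol dist_norm x_def add.commute[of "r *\<^sub>R c"])
  qed
qed

end
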